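(* For all integers $s \geq t \geq 2$ there exists a constant $c_{t,s}$ such that for all $n \geq 1$, \[ \lambda(n, K_{t,s}) \leq c_{t,s}\, n^{1 - 2/t + 1/(t\, 2^{t-1})}. \]
   Context: $K_{t,s}$ is the complete bipartite graph with parts of sizes $t$ and $s$. An orthonormal representation of a graph $G$ is a map $f: V(G) \to \mathbb{R}^d$ (some $d$) with $\|f(u)\|=1$ for all $u$ and $\langle f(u), f(v)\rangle = 0$ for all distinct non-adjacent $u,v$. For a graph $G$, $\vartheta(\overline{G})$ equals the maximum, over all orthonormal representations $f$ of $G$, of the largest eigenvalue of the Gram matrix $(\langle f(u), f(v)\rangle)_{u,v}$. A graph is $H$-free if it contains no (not necessarily induced) subgraph isomorphic to $H$. $\lambda(n,H)$ denotes the maximum of $\vartheta(\overline{G})$ over all $H$-free simple graphs $G$ on $n$ vertices. *)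

theory Defs
  imports
    Complex_Main
    "Graph_Theory.Graph_Theory"
    "Jordan_Normal_Form.Spectral_Radius"
begin

text \<open>
  A finite simple graph is a \<^locale>\<open>pair_graph\<close>: a finite, loopfree, symmetric set of arcs
  without parallel arcs; distinct vertices \<open>u\<close>, \<open>v\<close> are adjacent iff \<open>(u, v) \<in> parcs G\<close>.
\<close>

definition complete_bipartite :: "nat \<Rightarrow> nat \<Rightarrow> nat pair_pre_digraph" where
  "complete_bipartite t s =
    \<lparr> pverts = {..<t + s},
      parcs = {..<t} \<times> {t..<t + s} \<union> {t..<t + s} \<times> {..<t} \<rparr>"

lemma complete_bipartite_digraph_complete_bipartite:
  "complete_bipartite_digraph t s (with_proj (complete_bipartite t s))"
  unfolding complete_bipartite_digraph_pair_def complete_bipartite_def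
  by (intro conjI exI[of _ "{..<t}"] exI[of _ "{t..<t + s}"]) auto

text \<open>No subgraph of \<open>G\<close>, induced or not, is isomorphic to \<open>H\<close>.\<close>

definition graph_free :: "'h pair_pre_digraph \<Rightarrow> 'a pair_pre_digraph \<Rightarrow> bool" where
  "graph_free H G \<longleftrightarrow>
    \<not> (\<exists>F. subgraph F (with_proj G) \<and> digraph_iso (with_proj H) F)"

definition orthonormal_rep :: "'a pair_pre_digraph \<Rightarrow> nat \<Rightarrow> ('a \<Rightarrow> real vec) \<Rightarrow> bool" where
  "orthonormal_rep G d f \<longleftrightarrow>
    (\<forall>u \<in> pverts G. f u \<in> carrier_vec d \<and> sqrt (f u \<bullet> f u) = 1) \<and>
    (\<forall>u \<in> pverts G. \<forall>v \<in> pverts G. u \<noteq> v \<and> (u, v) \<notin> parcs G \<longrightarrow> f u \<bullet> f v = 0)"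

text \<open>
  Rows and columns follow the increasing enumeration of the vertices; the spectrum does not
  depend on this choice.
\<close>

definition gram_matrix :: "('a :: linorder) pair_pre_digraph \<Rightarrow> ('a \<Rightarrow> real vec) \<Rightarrow> real mat" where
  "gram_matrix G f =
    (let vs = sorted_list_of_set (pverts G)
     in mat (length vs) (length vs) (\<lambda>(i, j). f (vs ! i) \<bullet> f (vs ! j)))"

text \<open>
  The Lovasz number of the complement of \<open>G\<close>, for \<open>G\<close> finite with at least one vertex. The Gram
  matrix is then real symmetric, so its real spectrum is finite and nonempty. The supremum over
  all dimensions \<open>d\<close> is a maximum: eigenvalues are bounded by the trace, which is the number \<open>n\<close>
  of vertices, and the Gram matrices form a compact set since \<open>d = n\<close> suffices.
\<close>

definition lovasz_theta_compl :: "('a :: linorder) pair_pre_digraph \<Rightarrow> real" where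
  "lovasz_theta_compl G = Sup {Max (spectrum (gram_matrix G f)) | d f. orthonormal_rep G d f}"

text \<open>
  As everything above is invariant under isomorphism, the graphs on \<open>n\<close> vertices are represented
  by the finitely many graphs with vertex set \<open>{..<n}\<close>.
\<close>

definition max_theta_free :: "nat \<Rightarrow> 'h pair_pre_digraph \<Rightarrow> real" where
  "max_theta_free n H =
    Max {lovasz_theta_compl G | G :: nat pair_pre_digraph.
      pair_graph G \<and> pverts G = {..<n} \<and> graph_free H G}"

end

theory Submission
  imports Defs "HOL-Analysis.L2_Norm"
begin

text \<open>
  Let \<open>e t = 1 - 2/t + 1/(t 2^(t-1))\<close>; then \<open>e 1 = 0\<close> and \<open>e (t+1) = (1 - 1/(t+1)) (1 + e t) / 2\<close>, and
  the bound \<open>O(n^(e t))\<close> follows by induction on \<open>t\<close>, starting from graphs of bounded degree. The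
  largest eigenvalue of a Gram matrix is at most its largest absolute row sum. The row sum at \<open>u\<close> is
  \<open>1 + \<langle>f u, \<Sum>v\<in>N. \<epsilon> v f v\<rangle>\<close> with signs \<open>\<epsilon>\<close> and \<open>N\<close> the neighbourhood of \<open>u\<close>, so it is at most
  \<open>1 + sqrt (|N| \<theta>)\<close>, where \<open>\<theta>\<close> is the largest eigenvalue of the Gram matrix on \<open>N\<close>. As \<open>N\<close> spans no
  \<open>K_{t,s}\<close> in a \<open>K_{t+1,s}\<close>-free graph, \<open>\<theta>\<close> is \<open>O(|N|^(e t))\<close> by induction. By the Kovari-Sos-Turan
  count, at least half of the vertices have degree \<open>O(n^(1 - 1/(t+1)))\<close>. On these the row sums are
  \<open>O(n^(e (t+1)))\<close>; the remaining vertices are handled recursively, since the largest eigenvalue is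
  subadditive under partitions of the vertex set, and the resulting series is geometric.
\<close>

subsection \<open>Gram matrices in coordinates\<close>

text \<open>Vectors are coordinate functions of which only the first \<open>d\<close> entries count,
  so linear combinations are plain sums and \<open>L2_set\<close> applies to them directly.\<close>

definition coord_inner :: "nat \<Rightarrow> ('a \<Rightarrow> nat \<Rightarrow> real) \<Rightarrow> 'a \<Rightarrow> 'a \<Rightarrow> real" where
  "coord_inner d a u v = (\<Sum>i<d. a u i * a v i)"

text \<open>Keeping the arc set \<open>E\<close> apart from the vertex set \<open>V\<close> makes
  restriction to a vertex subset a change of \<open>V\<close> alone.\<close>

definition coord_rep :: "nat \<Rightarrow> ('a \<times> 'a) set \<Rightarrow> 'a set \<Rightarrow> ('a \<Rightarrow> nat \<Rightarrow> real) \<Rightarrow> bool" where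
  "coord_rep d E V a \<longleftrightarrow>
    (\<forall>u\<in>V. coord_inner d a u u = 1) \<and>
    (\<forall>u\<in>V. \<forall>v\<in>V. u \<noteq> v \<and> (u, v) \<notin> E \<longrightarrow> coord_inner d a u v = 0)"

text \<open>
  The left-hand side below is the quadratic form of the Gram matrix of the vectors \<open>a v\<close>, so the
  least possible \<open>L\<close> is the largest eigenvalue of that matrix.
\<close>

definition bessel_bound :: "nat \<Rightarrow> ('a \<Rightarrow> nat \<Rightarrow> real) \<Rightarrow> 'a set \<Rightarrow> real \<Rightarrow> bool" where
  "bessel_bound d a V L \<longleftrightarrow>
    (\<forall>x. (\<Sum>i<d. (\<Sum>v\<in>V. x v * a v i)\<^sup>2) \<le> L * (\<Sum>v\<in>V. (x v)\<^sup>2))"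

definition nbrs :: "('a \<times> 'a) set \<Rightarrow> 'a set \<Rightarrow> 'a \<Rightarrow> 'a set" where
  "nbrs E V u = {v \<in> V. (u, v) \<in> E}"

text \<open>For irreflexive \<open>E\<close> the inclusion \<open>T \<times> S \<subseteq> E\<close>
  already makes \<open>T\<close> and \<open>S\<close> disjoint.\<close>

definition biclique_free :: "('a \<times> 'a) set \<Rightarrow> nat \<Rightarrow> nat \<Rightarrow> 'a set \<Rightarrow> bool" where
  "biclique_free E t s V \<longleftrightarrow>
    \<not> (\<exists>T S. T \<subseteq> V \<and> S \<subseteq> V \<and> card T = t \<and> card S = s \<and> T \<times> S \<subseteq> E)"

lemma coord_inner_commute: "coord_inner d a u v = coord_inner d a v u"
  by (simp add: coord_inner_def mult.commute)

lemma coord_rep_subset: "coord_rep d E V a \<Longrightarrow> W \<subseteq> V \<Longrightarrow> coord_rep d E W a"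
  unfolding coord_rep_def by blast

lemma biclique_free_subset: "biclique_free E t s V \<Longrightarrow> W \<subseteq> V \<Longrightarrow> biclique_free E t s W"
  unfolding biclique_free_def by (blast intro: order_trans)

lemma bessel_boundD:
  "bessel_bound d a V L \<Longrightarrow> (\<Sum>i<d. (\<Sum>v\<in>V. x v * a v i)\<^sup>2) \<le> L * (\<Sum>v\<in>V. (x v)\<^sup>2)"
  by (simp add: bessel_bound_def)

lemma bessel_bound_mono:
  assumes "bessel_bound d a V L" "L \<le> M"
  shows "bessel_bound d a V M"
  unfolding bessel_bound_def
proof
  fix x
  have "L * (\<Sum>v\<in>V. (x v)\<^sup>2) \<le> M * (\<Sum>v\<in>V. (x v)\<^sup>2)"
    using assms(2) by (intro mult_right_mono sum_nonneg) auto
  with bessel_boundD[OF assms(1)]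
  show "(\<Sum>i<d. (\<Sum>v\<in>V. x v * a v i)\<^sup>2) \<le> M * (\<Sum>v\<in>V. (x v)\<^sup>2)"
    by (rule order_trans)
qed

lemma sum_squares_expand:
  "(\<Sum>i<d. (\<Sum>v\<in>V. x v * a v i)\<^sup>2) = (\<Sum>u\<in>V. \<Sum>v\<in>V. x u * x v * coord_inner d a u v)"
proof -
  have "(\<Sum>i<d. (\<Sum>v\<in>V. x v * a v i)\<^sup>2)
      = (\<Sum>i<d. \<Sum>u\<in>V. \<Sum>v\<in>V. x u * x v * (a u i * a v i))"
    by (simp add: power2_eq_square sum_product algebra_simps)
  also have "\<dots> = (\<Sum>u\<in>V. \<Sum>i<d. \<Sum>v\<in>V. x u * x v * (a u i * a v i))"
    by (rule sum.swap)
  also have "\<dots> = (\<Sum>u\<in>V. \<Sum>v\<in>V. \<Sum>i<d. x u * x v * (a u i * a v i))"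
    by (intro sum.cong refl sum.swap)
  finally show ?thesis by (simp add: coord_inner_def sum_distrib_left)
qed

text \<open>Schur test: AM-GM splits each entry of the quadratic form between its row and its
  column, and by symmetry the two halves add up to the same row sums.\<close>

lemma bessel_bound_row_sum:
  assumes row: "\<And>u. u \<in> V \<Longrightarrow> (\<Sum>v\<in>V. \<bar>coord_inner d a u v\<bar>) \<le> L"
  shows "bessel_bound d a V L"
  unfolding bessel_bound_def
proof
  fix x
  let ?g = "coord_inner d a"
  have am: "x u * x v * ?g u v \<le> ((x u)\<^sup>2 * \<bar>?g u v\<bar> + (x v)\<^sup>2 * \<bar>?g u v\<bar>) / 2" for u v
  proof -
    have "2 * \<bar>x u * x v\<bar> \<le> (x u)\<^sup>2 + (x v)\<^sup>2"
      using sum_squares_bound[of "\<bar>x u\<bar>" "\<bar>x v\<bar>"] by (simp add: abs_mult)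
    then have "2 * \<bar>x u * x v\<bar> * \<bar>?g u v\<bar> \<le> ((x u)\<^sup>2 + (x v)\<^sup>2) * \<bar>?g u v\<bar>"
      by (intro mult_right_mono) auto
    moreover have "x u * x v * ?g u v \<le> \<bar>x u * x v\<bar> * \<bar>?g u v\<bar>"
      by (metis abs_ge_self abs_mult)
    ultimately show ?thesis by (simp add: algebra_simps)
  qed
  have "(\<Sum>i<d. (\<Sum>v\<in>V. x v * a v i)\<^sup>2) = (\<Sum>u\<in>V. \<Sum>v\<in>V. x u * x v * ?g u v)"
    by (rule sum_squares_expand)
  also have "\<dots> \<le> (\<Sum>u\<in>V. \<Sum>v\<in>V. ((x u)\<^sup>2 * \<bar>?g u v\<bar> + (x v)\<^sup>2 * \<bar>?g u v\<bar>) / 2)"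
    by (intro sum_mono am)
  also have "\<dots> = ((\<Sum>u\<in>V. \<Sum>v\<in>V. (x u)\<^sup>2 * \<bar>?g u v\<bar>) + (\<Sum>u\<in>V. \<Sum>v\<in>V. (x v)\<^sup>2 * \<bar>?g u v\<bar>)) / 2"
    by (simp add: sum.distrib flip: sum_divide_distrib)
  also have "(\<Sum>u\<in>V. \<Sum>v\<in>V. (x v)\<^sup>2 * \<bar>?g u v\<bar>) = (\<Sum>u\<in>V. \<Sum>v\<in>V. (x u)\<^sup>2 * \<bar>?g u v\<bar>)"
    by (subst sum.swap) (simp add: coord_inner_commute)
  also have "((\<Sum>u\<in>V. \<Sum>v\<in>V. (x u)\<^sup>2 * \<bar>?g u v\<bar>) + (\<Sum>u\<in>V. \<Sum>v\<in>V. (x u)\<^sup>2 * \<bar>?g u v\<bar>)) / 2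
      = (\<Sum>u\<in>V. (x u)\<^sup>2 * (\<Sum>v\<in>V. \<bar>?g u v\<bar>))"
    by (simp flip: sum_distrib_left)
  also have "\<dots> \<le> (\<Sum>u\<in>V. (x u)\<^sup>2 * L)"
    by (intro sum_mono mult_left_mono row) auto
  finally show "(\<Sum>i<d. (\<Sum>v\<in>V. x v * a v i)\<^sup>2) \<le> L * (\<Sum>v\<in>V. (x v)\<^sup>2)"
    by (simp add: sum_distrib_left mult.commute)
qed

lemma coord_cauchy_schwarz:
  assumes "coord_inner d a u u = 1"
  shows "\<bar>\<Sum>i<d. a u i * b i\<bar> \<le> sqrt (\<Sum>i<d. (b i)\<^sup>2)"
proof -
  have "\<bar>\<Sum>i<d. a u i * b i\<bar> \<le> (\<Sum>i<d. \<bar>a u i\<bar> * \<bar>b i\<bar>)"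
    using sum_abs[of "\<lambda>i. a u i * b i"] by (simp add: abs_mult)
  also have "\<dots> \<le> L2_set (a u) {..<d} * L2_set b {..<d}"
    by (rule L2_set_mult_ineq)
  also have "\<dots> = sqrt (\<Sum>i<d. (b i)\<^sup>2)"
    using assms by (simp add: L2_set_def coord_inner_def power2_eq_square)
  finally show ?thesis .
qed

text \<open>Weighting each \<open>a v\<close> by the sign of its inner product with
  \<open>a u\<close> turns the sum into a single inner product with a unit vector; Cauchy-Schwarz
  and the Bessel bound finish.\<close>

lemma sum_abs_coord_inner_le:
  assumes "bessel_bound d a N L" "coord_inner d a u u = 1" "0 \<le> L" "finite N"
  shows "(\<Sum>v\<in>N. \<bar>coord_inner d a u v\<bar>) \<le> sqrt (L * real (card N))"
proof -
  let ?x = "\<lambda>v. sgn (coord_inner d a u v)"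
  have "(\<Sum>v\<in>N. \<bar>coord_inner d a u v\<bar>) = (\<Sum>v\<in>N. \<Sum>i<d. a u i * (?x v * a v i))"
    by (simp add: abs_sgn coord_inner_def sum_distrib_left sum_distrib_right mult_ac)
  also have "\<dots> = (\<Sum>i<d. a u i * (\<Sum>v\<in>N. ?x v * a v i))"
    by (subst sum.swap) (simp add: sum_distrib_left)
  also have "\<dots> \<le> sqrt (\<Sum>i<d. (\<Sum>v\<in>N. ?x v * a v i)\<^sup>2)"
    by (rule order_trans[OF abs_ge_self coord_cauchy_schwarz[OF assms(2)]])
  also have "\<dots> \<le> sqrt (L * (\<Sum>v\<in>N. (?x v)\<^sup>2))"
    using assms(1) by (simp add: bessel_boundD)
  also have "\<dots> \<le> sqrt (L * real (card N))"
  proof -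
    have "(\<Sum>v\<in>N. (?x v)\<^sup>2) \<le> (\<Sum>v\<in>N. 1)"
      by (intro sum_mono) (auto simp: sgn_if)
    then show ?thesis using assms(3) by (simp add: mult_left_mono)
  qed
  finally show ?thesis .
qed

lemma sum_abs_coord_inner_nbrs:
  assumes "coord_rep d E V a" "u \<in> V" "finite V"
  shows "(\<Sum>v\<in>V. \<bar>coord_inner d a u v\<bar>) \<le> 1 + (\<Sum>v\<in>nbrs E V u. \<bar>coord_inner d a u v\<bar>)"
proof -
  have "(\<Sum>v\<in>V. \<bar>coord_inner d a u v\<bar>) = (\<Sum>v\<in>insert u (nbrs E V u). \<bar>coord_inner d a u v\<bar>)"
    using assms by (intro sum.mono_neutral_right) (auto simp: nbrs_def coord_rep_def)
  \<comment> \<open>Loops are allowed in \<open>E\<close> here; if \<open>u\<close> is its own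
    neighbour, \<open>insert\<close> adds nothing, hence only an inequality.\<close>
  also have "\<dots> \<le> \<bar>coord_inner d a u u\<bar> + (\<Sum>v\<in>nbrs E V u. \<bar>coord_inner d a u v\<bar>)"
    using assms(3) by (simp add: sum.insert_if nbrs_def)
  also have "\<bar>coord_inner d a u u\<bar> = 1"
    using assms by (simp add: coord_rep_def)
  finally show ?thesis .
qed

text \<open>The triangle inequality bounds the norm by \<open>sqrt (L * A) + sqrt (M * B)\<close>,
  whose square is at most \<open>(L + M) * (A + B)\<close>.\<close>

lemma bessel_bound_union:
  assumes "bessel_bound d a V L" "bessel_bound d a W M" "0 \<le> L" "0 \<le> M"
    and "finite V" "finite W" "V \<inter> W = {}"
  shows "bessel_bound d a (V \<union> W) (L + M)"
  unfolding bessel_bound_def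
proof
  fix x
  define p q where "p = (\<lambda>i. \<Sum>v\<in>V. x v * a v i)" and "q = (\<lambda>i. \<Sum>v\<in>W. x v * a v i)"
  define A B where "A = (\<Sum>v\<in>V. (x v)\<^sup>2)" and "B = (\<Sum>v\<in>W. (x v)\<^sup>2)"
  have [simp]: "A \<ge> 0" "B \<ge> 0" by (simp_all add: A_def B_def sum_nonneg)
  have P: "L2_set p {..<d} \<le> sqrt (L * A)" and Q: "L2_set q {..<d} \<le> sqrt (M * B)"
    unfolding L2_set_def p_def q_def A_def B_def
    using assms(1,2) by (simp_all add: bessel_boundD)
  have "L2_set (\<lambda>i. p i + q i) {..<d} \<le> sqrt (L * A) + sqrt (M * B)"
    using L2_set_triangle_ineq[of p q "{..<d}"] P Q by linarith
  then have "(L2_set (\<lambda>i. p i + q i) {..<d})\<^sup>2 \<le> (sqrt (L * A) + sqrt (M * B))\<^sup>2"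
    by (intro power_mono) (auto simp: L2_set_nonneg)
  \<comment> \<open>The cross term is regrouped so that AM-GM yields exactly the missing products
    \<open>L * B\<close> and \<open>M * A\<close>.\<close>
  also have "\<dots> = L * A + M * B + 2 * (sqrt (L * B) * sqrt (M * A))"
    using assms(3,4) by (simp add: power2_sum real_sqrt_mult power_mult_distrib)
  also have "\<dots> \<le> L * A + M * B + (L * B + M * A)"
    using sum_squares_bound[of "sqrt (L * B)" "sqrt (M * A)"] assms(3,4) by simp
  also have "\<dots> = (L + M) * (A + B)" by (simp add: algebra_simps)
  also have "(L2_set (\<lambda>i. p i + q i) {..<d})\<^sup>2 = (\<Sum>i<d. (\<Sum>v\<in>V \<union> W. x v * a v i)\<^sup>2)"
    using assms by (simp add: L2_set_def sum_nonneg p_def q_def sum.union_disjoint)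
  also have "A + B = (\<Sum>v\<in>V \<union> W. (x v)\<^sup>2)"
    using assms by (simp add: A_def B_def sum.union_disjoint)
  finally show "(\<Sum>i<d. (\<Sum>v\<in>V \<union> W. x v * a v i)\<^sup>2) \<le> (L + M) * (\<Sum>v\<in>V \<union> W. (x v)\<^sup>2)" .
qed

text \<open>This carries the induction on \<open>t\<close>: a bound of exponent \<open>e\<close> on
  the neighbourhoods becomes a bound of exponent \<open>(1 + e) / 2\<close> in the degree on the
  whole set.\<close>

lemma bessel_bound_degree:
  assumes "coord_rep d E V a" "finite V" "0 \<le> c" "0 \<le> e"
    and deg: "\<And>u. u \<in> V \<Longrightarrow> real (card (nbrs E V u)) \<le> D"
    and nb: "\<And>u. u \<in> V \<Longrightarrow>
      bessel_bound d a (nbrs E V u) (c * real (card (nbrs E V u)) powr e)"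
  shows "bessel_bound d a V (1 + sqrt (c * D powr e * D))"
proof (rule bessel_bound_row_sum)
  fix u assume u: "u \<in> V"
  let ?k = "real (card (nbrs E V u))"
  have fin: "finite (nbrs E V u)" using assms(2) by (simp add: nbrs_def)
  have "(\<Sum>v\<in>V. \<bar>coord_inner d a u v\<bar>) \<le> 1 + (\<Sum>v\<in>nbrs E V u. \<bar>coord_inner d a u v\<bar>)"
    using assms u by (intro sum_abs_coord_inner_nbrs)
  also have "\<dots> \<le> 1 + sqrt (c * ?k powr e * ?k)"
    using nb[OF u] assms u fin
    by (intro add_left_mono sum_abs_coord_inner_le) (auto simp: coord_rep_def)
  also have "\<dots> \<le> 1 + sqrt (c * D powr e * D)"
    using deg[OF u] assms(3,4)
    by (intro add_left_mono real_sqrt_le_mono mult_mono powr_mono2 mult_nonneg_nonneg) auto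
  finally show "(\<Sum>v\<in>V. \<bar>coord_inner d a u v\<bar>) \<le> 1 + sqrt (c * D powr e * D)" .
qed

text \<open>Unit vectors have inner products of absolute value at most 1, so a row sum is at most 1
  plus the degree. This serves the base case \<open>t = 1\<close>.\<close>

lemma bessel_bound_max_degree:
  assumes "coord_rep d E V a" "finite V"
    and deg: "\<And>u. u \<in> V \<Longrightarrow> card (nbrs E V u) \<le> D"
  shows "bessel_bound d a V (1 + real D)"
proof (rule bessel_bound_row_sum)
  fix u assume u: "u \<in> V"
  have le1: "\<bar>coord_inner d a u v\<bar> \<le> 1" if "v \<in> V" for v
    using coord_cauchy_schwarz[of d a u "a v"] assms(1) u that
    by (simp add: coord_rep_def coord_inner_def power2_eq_square)
  have "(\<Sum>v\<in>V. \<bar>coord_inner d a u v\<bar>) \<le> 1 + (\<Sum>v\<in>nbrs E V u. \<bar>coord_inner d a u v\<bar>)"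
    using assms u by (intro sum_abs_coord_inner_nbrs)
  also have "(\<Sum>v\<in>nbrs E V u. \<bar>coord_inner d a u v\<bar>) \<le> (\<Sum>v\<in>nbrs E V u. 1)"
    by (intro sum_mono le1) (auto simp: nbrs_def)
  also have "\<dots> \<le> real D" using deg[OF u] by simp
  finally show "(\<Sum>v\<in>V. \<bar>coord_inner d a u v\<bar>) \<le> 1 + real D" by simp
qed

subsection \<open>Biclique-free graphs\<close>

text \<open>The Kovari-Sos-Turan double count of pairs of a vertex and a \<open>t\<close>-subset of its neighbourhood.\<close>

lemma card_high_degree:
  fixes E :: "('a \<times> 'a) set"
  assumes "finite V" "sym E" "biclique_free E t s V" "t \<ge> 1" "s \<ge> 1"
  defines "n \<equiv> card V"
  defines "D \<equiv> real t * (2 * real s) powr (1 / real t) * real n powr (1 - 1 / real t)"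
  shows "2 * card {v \<in> V. D < real (card (nbrs E V v))} \<le> n"
proof (rule ccontr)
  define H where "H = {v \<in> V. D < real (card (nbrs E V v))}"
  define P where "P = {T. T \<subseteq> V \<and> card T = t}"
  assume "\<not> 2 * card {v \<in> V. D < real (card (nbrs E V v))} \<le> n"
  then have big: "n < 2 * card H" by (simp add: H_def)
  have fH: "finite H" and fP: "finite P" using assms(1) by (auto simp: H_def P_def)
  have "H \<noteq> {}" using big by auto
  then have n: "n \<ge> 1"
    using assms(1) by (auto simp: H_def n_def Suc_le_eq card_gt_0_iff)
  \<comment> \<open>\<open>D\<close> is chosen to make \<open>(D / t) ^ t\<close> equal to
    \<open>2 * s * n ^ (t - 1)\<close>, a lower bound for the number of \<open>t\<close>-subsets in
    a neighbourhood larger than \<open>D\<close>.\<close>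
  have "D / real t = (2 * real s) powr (1 / real t) * real n powr (1 - 1 / real t)"
    using assms(4) by (simp add: D_def)
  then have "(D / real t) ^ t = (2 * real s) * real n powr ((1 - 1 / real t) * real t)"
    using assms(4,5) n by (simp add: power_mult_distrib powr_power mult.commute)
  also have "(1 - 1 / real t) * real t = real (t - 1)"
    using assms(4) by (simp add: field_simps of_nat_diff)
  finally have Dt: "(D / real t) ^ t = 2 * real s * real n ^ (t - 1)"
    using n by (simp add: powr_realpow)
  \<comment> \<open>Both factors are at least 1, so \<open>t \<le> D\<close>; the estimate of the
    binomial coefficient by \<open>(k / t) ^ t\<close> requires \<open>t \<le> k\<close>.\<close>
  have "1 \<le> (2 * real s) powr (1 / real t)" "1 \<le> real n powr (1 - 1 / real t)"
    using assms(4,5) n by (auto intro!: ge_one_powr_ge_zero)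
  then have "1 \<le> (2 * real s) powr (1 / real t) * real n powr (1 - 1 / real t)"
    using mult_mono[of 1 _ 1] by fastforce
  then have tD: "real t \<le> D"
    unfolding D_def mult.assoc using mult_left_mono[of 1 _ "real t"] by fastforce
  have low: "2 * real s * real n ^ (t - 1) \<le> real (card {T \<in> P. T \<subseteq> nbrs E V v})" if "v \<in> H" for v
  proof -
    let ?k = "card (nbrs E V v)"
    have k: "D < real ?k" using that by (simp add: H_def)
    have "2 * real s * real n ^ (t - 1) \<le> (real ?k / real t) ^ t"
      unfolding Dt[symmetric] using k tD by (intro power_mono divide_right_mono) auto
    also have "\<dots> \<le> real (?k choose t)"
      using k tD by (intro binomial_ge_n_over_k_pow_k) linarith
    also have "?k choose t = card {T. T \<subseteq> nbrs E V v \<and> card T = t}"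
      using assms(1) by (subst n_subsets) (auto simp: nbrs_def)
    also have "{T. T \<subseteq> nbrs E V v \<and> card T = t} = {T \<in> P. T \<subseteq> nbrs E V v}"
      by (auto simp: P_def nbrs_def)
    finally show ?thesis .
  qed
  \<comment> \<open>Already \<open>s\<close> common neighbours would complete a biclique, so
    \<open>s\<close> is one above the sharp value; the strict inequality in the count comes from
    \<open>n < 2 * card H\<close>.\<close>
  have up: "card {v \<in> H. T \<subseteq> nbrs E V v} \<le> s" if "T \<in> P" for T
  proof (rule ccontr)
    assume "\<not> card {v \<in> H. T \<subseteq> nbrs E V v} \<le> s"
    then obtain S where S: "S \<subseteq> {v \<in> H. T \<subseteq> nbrs E V v}" "card S = s"
      using obtain_subset_with_card_n[of s "{v \<in> H. T \<subseteq> nbrs E V v}"] by auto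
    then have "T \<times> S \<subseteq> E" using assms(2) by (auto simp: nbrs_def dest: symD)
    moreover have "S \<subseteq> V" using S by (auto simp: H_def)
    ultimately show False
      using assms(3) S that unfolding biclique_free_def P_def by blast
  qed
  have "real n * (real s * real n ^ (t - 1)) < real (2 * card H) * (real s * real n ^ (t - 1))"
    using big n assms(5) by (intro mult_strict_right_mono) auto
  also have "\<dots> = (\<Sum>v\<in>H. 2 * real s * real n ^ (t - 1))" by simp
  also have "\<dots> \<le> (\<Sum>v\<in>H. real (card {T \<in> P. T \<subseteq> nbrs E V v}))"
    by (intro sum_mono low)
  also have "\<dots> = real (\<Sum>v\<in>H. card {T \<in> P. T \<subseteq> nbrs E V v})"
    by (rule of_nat_sum[symmetric])
  also have "(\<Sum>v\<in>H. card {T \<in> P. T \<subseteq> nbrs E V v}) = (\<Sum>T\<in>P. card {v \<in> H. T \<subseteq> nbrs E V v})"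
    using fH fP by (rule sum_multicount_gen) simp
  also have "\<dots> \<le> real (\<Sum>T\<in>P. s)"
    using up by (intro of_nat_mono sum_mono)
  also have "\<dots> = real (n choose t) * real s"
    using assms(1) by (simp add: P_def n_subsets n_def)
  also have "\<dots> \<le> real (n ^ t) * real s"
  proof (cases "t \<le> n")
    case True
    then show ?thesis using binomial_le_pow[of t n] by (intro mult_right_mono of_nat_mono) auto
  qed (simp add: binomial_eq_0)
  also have "\<dots> = real n * (real s * real n ^ (t - 1))"
    using assms(4) by (cases t) auto
  finally show False by simp
qed

section \<open>The exponent and its recursion\<close>

definition theta_exponent :: "nat \<Rightarrow> real" where
  "theta_exponent t = 1 - 2 / real t + 1 / (real t * 2 ^ (t - 1))"

lemma theta_exponent_nonneg:
  assumes "t \<ge> 1"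
  shows "theta_exponent t \<ge> 0"
proof (cases "t = 1")
  case False
  then have "2 / real t \<le> 1" using assms by simp
  moreover have "1 / (real t * 2 ^ (t - 1)) \<ge> 0" by simp
  ultimately show ?thesis unfolding theta_exponent_def by linarith
qed (simp add: theta_exponent_def)

text \<open>The recursion mirrors the induction step: for degrees \<open>D\<close> of order
  \<open>n powr (1 - 1 / (t + 1))\<close>, the row sums are of order
  \<open>sqrt (D powr (1 + e))\<close>.\<close>

lemma theta_exponent_Suc:
  assumes "t \<ge> 1"
  shows "theta_exponent (Suc t) = (1 - 1 / real (Suc t)) * (1 + theta_exponent t) / 2"
proof -
  \<comment> \<open>The power \<open>2 ^ (t - 1)\<close> becomes a free variable \<open>p\<close>,
    which leaves a rational identity.\<close>
  have id: "1 - 2 / (1 + x) + 1 / ((1 + x) * (2 * p)) = (1 - 1 / (1 + x)) * (1 + (1 - 2 / x + 1 / (x * p))) / 2"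
    if "x > 0" "p > 0" for x p :: real
  proof -
    have "(1 - 1 / (1 + x)) * (1 + (1 - 2 / x + 1 / (x * p))) / 2
        = (x / (1 + x)) * ((2 * x * p - 2 * p + 1) / (x * p)) / 2"
      using that by (intro arg_cong2[where f = "\<lambda>y z. y * z / 2"]) (auto simp: field_simps)
    also have "\<dots> = (2 * x * p - 2 * p + 1) / (2 * p * (1 + x))"
      using that by simp
    also have "\<dots> = 1 - 2 / (1 + x) + 1 / ((1 + x) * (2 * p))"
      using that by (simp add: divide_simps) (simp add: algebra_simps)
    finally show ?thesis by (rule sym)
  qed
  have "(2::real) ^ (Suc t - 1) = 2 * 2 ^ (t - 1)"
    using assms by (cases t) auto
  then show ?thesis
    unfolding theta_exponent_def of_nat_Suc using id[of "real t" "2 ^ (t - 1)"] assms by simp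
qed

text \<open>Positivity makes the ratio \<open>2 powr - e\<close> of the geometric series less than
  1. At \<open>t = 1\<close> the exponent is 0, so that case goes through bounded degrees
  instead.\<close>

lemma theta_exponent_Suc_pos:
  assumes "t \<ge> 1"
  shows "theta_exponent (Suc t) > 0"
  unfolding theta_exponent_Suc[OF assms]
  using theta_exponent_nonneg[OF assms] assms by (intro divide_pos_pos mult_pos_pos) auto

section \<open>Neighbourhoods, halving and the induction on \<open>t\<close>\<close>

lemma nbrs_subset: "nbrs E V u \<subseteq> V"
  by (auto simp: nbrs_def)

text \<open>Adding \<open>u\<close> to the \<open>t\<close>-side of a biclique inside its
  neighbourhood enlarges that side by one; irreflexivity keeps \<open>u\<close> out of
  \<open>T\<close>.\<close>

lemma biclique_free_nbrs:
  assumes "finite V" "irrefl E" "biclique_free E (Suc t) s V" "u \<in> V"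
  shows "biclique_free E t s (nbrs E V u)"
  unfolding biclique_free_def
proof
  assume "\<exists>T S. T \<subseteq> nbrs E V u \<and> S \<subseteq> nbrs E V u \<and> card T = t \<and> card S = s \<and> T \<times> S \<subseteq> E"
  then obtain T S where TS: "T \<subseteq> nbrs E V u" "S \<subseteq> nbrs E V u" "card T = t" "card S = s"
    "T \<times> S \<subseteq> E" by blast
  have "finite T" using TS(1) assms(1) by (auto simp: nbrs_def intro: finite_subset)
  moreover have "u \<notin> T" using TS(1) assms(2) by (auto simp: nbrs_def irrefl_def)
  ultimately have "card (insert u T) = Suc t" using TS(3) by simp
  moreover have "insert u T \<times> S \<subseteq> E" using TS by (auto simp: nbrs_def)
  moreover have "insert u T \<subseteq> V" "S \<subseteq> V" using TS assms(4) by (auto simp: nbrs_def)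
  ultimately show False using assms(3) TS(4) unfolding biclique_free_def by blast
qed

lemma biclique_free_star_degree:
  assumes "biclique_free E 1 s V" "u \<in> V"
  shows "card (nbrs E V u) \<le> s"
proof (rule ccontr)
  assume "\<not> card (nbrs E V u) \<le> s"
  then obtain S where S: "S \<subseteq> nbrs E V u" "card S = s"
    using obtain_subset_with_card_n[of s "nbrs E V u"] by auto
  then have "{u} \<times> S \<subseteq> E" "S \<subseteq> V" "{u} \<subseteq> V" "card {u} = 1"
    using assms(2) by (auto simp: nbrs_def)
  with S(2) show False using assms(1) unfolding biclique_free_def by blast
qed

text \<open>Removing \<open>W\<close> leaves at most half of the vertices, so the costs of
  successive rounds decay by the factor \<open>2 powr - e\<close>, and
  \<open>K / (1 - 2 powr - e)\<close> sums the series. Hypothesis \<open>low\<close> ranges over all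
  vertex sets because it is applied again to each remainder.\<close>

lemma bessel_bound_halving:
  assumes "finite V" "biclique_free E t s V" "coord_rep d E V a"
    and e: "e > 0" and K: "K \<ge> 0"
    and low: "\<And>V. finite V \<Longrightarrow> V \<noteq> {} \<Longrightarrow> biclique_free E t s V \<Longrightarrow> coord_rep d E V a \<Longrightarrow>
      \<exists>W\<subseteq>V. card V \<le> 2 * card W \<and> bessel_bound d a W (K * real (card V) powr e)"
  shows "bessel_bound d a V (K / (1 - 2 powr - e) * real (card V) powr e)"
  using assms(1-3)
proof (induction "card V" arbitrary: V rule: less_induct)
  case less
  show ?case
  proof (cases "V = {}")
    case True
    then show ?thesis by (simp add: bessel_bound_def)
  next
    case False
    define n where "n = card V"
    define r where "r = (2::real) powr - e"
    have r: "r < 1" "r \<ge> 0" using e by (auto simp: r_def powr_less_one)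
    define C where "C = K / (1 - r)"
    have C: "C \<ge> 0" "K + C * r = C" using r K by (auto simp: C_def divide_simps algebra_simps)
    have n: "n > 0" using False less.prems(1) by (auto simp: n_def card_gt_0_iff)
    obtain W where W: "W \<subseteq> V" "n \<le> 2 * card W" "bessel_bound d a W (K * real n powr e)"
      using low[OF less.prems(1) False less.prems(2,3)] n_def by blast
    let ?U = "V - W"
    have cU: "card ?U = n - card W"
      using W(1) less.prems(1) n_def card_Diff_subset finite_subset by metis
    \<comment> \<open>Since \<open>n > 0\<close>, the set \<open>W\<close> is nonempty and the
      remainder is strictly smaller.\<close>
    have "bessel_bound d a ?U (C * real (card ?U) powr e)"
      unfolding C_def r_def
      using less.prems W(2) n cU n_def
      by (intro less.hyps) (auto intro: biclique_free_subset coord_rep_subset)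
    moreover have "real (card ?U) powr e \<le> (real n / 2) powr e"
      using cU W(2) e by (intro powr_mono2) auto
    then have "C * real (card ?U) powr e \<le> C * r * real n powr e"
      using mult_left_mono[OF _ C(1)] by (fastforce simp: powr_divide r_def powr_minus_divide)
    ultimately have "bessel_bound d a ?U (C * r * real n powr e)"
      by (rule bessel_bound_mono)
    with W(3) have "bessel_bound d a (W \<union> ?U) (K * real n powr e + C * r * real n powr e)"
      using K C(1) r less.prems(1) W(1)
      by (intro bessel_bound_union) (auto intro: finite_subset)
    moreover have "W \<union> ?U = V" using W(1) by auto
    moreover have "K * real n powr e + C * r * real n powr e = C * real n powr e"
      using C(2) by (metis distrib_right)
    ultimately show ?thesis by (simp add: C_def r_def n_def)
  qed
qed

text \<open>The constant is chosen before \<open>d\<close>, \<open>a\<close>, \<open>E\<close> and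
  \<open>V\<close>: the induction step needs one constant for all neighbourhoods at once.\<close>

lemma bessel_bound_biclique_free:
  assumes "t \<ge> 1" "s \<ge> 1"
  shows "\<exists>c\<ge>0. \<forall>d (a :: 'a \<Rightarrow> nat \<Rightarrow> real) E V.
    finite V \<longrightarrow> irrefl E \<longrightarrow> sym E \<longrightarrow> biclique_free E t s V \<longrightarrow> coord_rep d E V a \<longrightarrow>
    bessel_bound d a V (c * real (card V) powr theta_exponent t)"
  using assms(1)
proof (induction t rule: nat_induct_at_least)
  case base
  have "bessel_bound d a V ((1 + real s) * real (card V) powr theta_exponent 1)"
    if "finite V" "biclique_free E 1 s V" "coord_rep d E V a"
    for d and a :: "'a \<Rightarrow> nat \<Rightarrow> real" and E V
  \<comment> \<open>As \<open>0 powr 0 = 0\<close>, the empty set is treated apart; otherwise the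
    power with exponent 0 is 1.\<close>
  proof (cases "V = {}")
    case False
    have "bessel_bound d a V (1 + real s)"
      using that biclique_free_star_degree by (intro bessel_bound_max_degree)
    with that(1) False show ?thesis by (simp add: theta_exponent_def)
  qed (simp add: bessel_bound_def)
  then show ?case by (intro exI[of _ "1 + real s"]) auto
next
  case (Suc t)
  define e where "e = theta_exponent t"
  define e' where "e' = theta_exponent (Suc t)"
  have e: "e \<ge> 0" "e' > 0" "e' = (1 - 1 / real (Suc t)) * (1 + e) / 2"
    unfolding e_def e'_def
    using Suc.hyps by (fact theta_exponent_nonneg theta_exponent_Suc_pos theta_exponent_Suc)+
  obtain c where c: "c \<ge> 0"
    and IH: "\<And>d (a :: 'a \<Rightarrow> nat \<Rightarrow> real) E V. finite V \<Longrightarrow> irrefl E \<Longrightarrow> sym E \<Longrightarrow>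
      biclique_free E t s V \<Longrightarrow> coord_rep d E V a \<Longrightarrow>
      bessel_bound d a V (c * real (card V) powr e)"
    using Suc.IH unfolding e_def by blast
  \<comment> \<open>\<open>B\<close> is the constant of the degree threshold in
    \<open>card_high_degree\<close>; \<open>K\<close> is what remains of the row sum bound once the
    power of \<open>n\<close> is factored out.\<close>
  define B where "B = real (Suc t) * (2 * real s) powr (1 / real (Suc t))"
  define K where "K = 1 + sqrt (c * B powr e * B)"
  have B: "B > 0" using assms(2) by (simp add: B_def)
  have K: "K \<ge> 0" using B c by (simp add: K_def)
  have main: "bessel_bound d a V (K / (1 - 2 powr - e') * real (card V) powr e')"
    if "finite V" "irrefl E" "sym E" "biclique_free E (Suc t) s V" "coord_rep d E V a"
    for d and a :: "'a \<Rightarrow> nat \<Rightarrow> real" and E V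
    using that(1,4,5) e(2) K
  proof (rule bessel_bound_halving)
    fix V :: "'a set"
    assume V: "finite V" "V \<noteq> {}" "biclique_free E (Suc t) s V" "coord_rep d E V a"
    define n where "n = card V"
    define D where "D = B * real n powr (1 - 1 / real (Suc t))"
    define W where "W = {v \<in> V. real (card (nbrs E V v)) \<le> D}"
    have n: "n \<ge> 1" using V(1,2) by (simp add: n_def Suc_le_eq card_gt_0_iff)
    have "2 * card {v \<in> V. D < real (card (nbrs E V v))} \<le> n"
      unfolding D_def B_def n_def
      using V that assms(2) by (intro card_high_degree) auto
    moreover have "card W + card {v \<in> V. D < real (card (nbrs E V v))} = n"
      unfolding n_def W_def using V(1)
      by (subst card_Un_disjoint[symmetric]) (auto intro!: arg_cong[where f = card])
    ultimately have half: "n \<le> 2 * card W" by linarith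
    have WV: "W \<subseteq> V" by (auto simp: W_def)
    have fW: "finite W" using V(1) WV by (rule finite_subset[rotated])
    have "bessel_bound d a W (1 + sqrt (c * D powr e * D))"
    proof (rule bessel_bound_degree)
      show "coord_rep d E W a" using V(4) WV by (rule coord_rep_subset)
      fix u assume u: "u \<in> W"
      have "nbrs E W u \<subseteq> nbrs E V u" using WV by (auto simp: nbrs_def)
      then have "card (nbrs E W u) \<le> card (nbrs E V u)"
        using V(1) by (intro card_mono) (auto simp: nbrs_def)
      then show "real (card (nbrs E W u)) \<le> D" using u by (simp add: W_def)
      show "bessel_bound d a (nbrs E W u) (c * real (card (nbrs E W u)) powr e)"
      proof (rule IH)
        show "finite (nbrs E W u)" using fW nbrs_subset by (rule finite_subset[rotated])
        show "biclique_free E t s (nbrs E W u)"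
          using fW that(2) biclique_free_subset[OF V(3) WV] u by (rule biclique_free_nbrs)
        show "coord_rep d E (nbrs E W u) a"
          using V(4) WV nbrs_subset by (meson coord_rep_subset order_trans)
      qed (use that in auto)
    qed (use fW c e in auto)
    moreover have "1 + sqrt (c * D powr e * D) \<le> K * real n powr e'"
    proof -
      \<comment> \<open>By the recursion the exponent of \<open>n\<close> here is
        \<open>2 * e'\<close>, which the square root halves; the summand 1 is absorbed by
        \<open>1 \<le> n powr e'\<close>.\<close>
      have "D powr e * D = D powr (1 + e)"
        using B n by (simp add: powr_add D_def)
      also have "\<dots> = B powr (1 + e) * real n powr (2 * e')"
        using B unfolding e(3) by (simp add: D_def powr_mult powr_powr)
      also have "\<dots> = B powr e * B * (real n powr e')\<^sup>2"
        using B by (simp add: powr_add[of B] powr_add[symmetric] power2_eq_square)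
      finally have "sqrt (c * D powr e * D) = sqrt (c * B powr e * B) * real n powr e'"
        by (simp add: mult.assoc real_sqrt_mult)
      moreover have "1 \<le> real n powr e'" using n e(2) by (intro ge_one_powr_ge_zero) auto
      ultimately show ?thesis by (simp add: K_def algebra_simps)
    qed
    ultimately have "bessel_bound d a W (K * real n powr e')"
      by (rule bessel_bound_mono)
    with WV half show "\<exists>W\<subseteq>V. card V \<le> 2 * card W \<and> bessel_bound d a W (K * real (card V) powr e')"
      unfolding n_def by blast
  qed
  have "2 powr - e' < (1::real)" using e(2) by (simp add: powr_less_one)
  then have "K / (1 - 2 powr - e') \<ge> 0" using K by simp
  with main show ?case unfolding e'_def by blast
qed

subsection \<open>Spectra of Gram matrices\<close>

text \<open>
  For a complex eigenvector \<open>p + i q\<close> of a real symmetric \<open>A\<close> with eigenvalue \<open>a + i b\<close>, comparing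
  \<open>q \<bullet> A p\<close> with \<open>p \<bullet> A q\<close> gives \<open>b (|p|^2 + |q|^2) = 0\<close>.
\<close>

lemma symmetric_real_eigenvalue_exists:
  fixes A :: "real mat"
  assumes A: "A \<in> carrier_mat n n" and n: "n > 0"
    and sym: "\<And>i j. i < n \<Longrightarrow> j < n \<Longrightarrow> A $$ (i, j) = A $$ (j, i)"
  shows "\<exists>k. eigenvalue A k"
proof -
  define C where "C = map_mat complex_of_real A"
  have C: "C \<in> carrier_mat n n" using A by (simp add: C_def)
  obtain z where "eigenvalue C z"
    using spectrum_non_empty[OF C n] by (auto simp: spectrum_def)
  then obtain w where w: "w \<in> carrier_vec n" "w \<noteq> 0\<^sub>v n" "C *\<^sub>v w = z \<cdot>\<^sub>v w"
    using C by (auto simp: eigenvalue_def eigenvector_def)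
  define p q where "p = (\<lambda>i. Re (w $ i))" and "q = (\<lambda>i. Im (w $ i))"
  have eq: "(\<Sum>j<n. of_real (A $$ (i, j)) * w $ j) = z * w $ i" if "i < n" for i
  proof -
    have "(C *\<^sub>v w) $ i = (\<Sum>j<n. of_real (A $$ (i, j)) * w $ j)"
      using A w(1) that by (simp add: C_def scalar_prod_def row_def lessThan_atLeast0)
    then show ?thesis using w that by simp
  qed
  have p: "(\<Sum>j<n. A $$ (i, j) * p j) = Re z * p i - Im z * q i"
    and q: "(\<Sum>j<n. A $$ (i, j) * q j) = Re z * q i + Im z * p i" if "i < n" for i
    using arg_cong[OF eq[OF that], of Re] arg_cong[OF eq[OF that], of Im]
    by (simp_all add: p_def q_def algebra_simps)
  have "(\<Sum>i<n. q i * (\<Sum>j<n. A $$ (i, j) * p j)) = (\<Sum>i<n. \<Sum>j<n. A $$ (i, j) * q i * p j)"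
    by (simp add: sum_distrib_left mult_ac)
  also have "\<dots> = (\<Sum>j<n. \<Sum>i<n. A $$ (i, j) * q i * p j)" by (rule sum.swap)
  also have "\<dots> = (\<Sum>j<n. \<Sum>i<n. A $$ (j, i) * q i * p j)"
    by (intro sum.cong refl) (simp add: sym)
  also have "\<dots> = (\<Sum>i<n. p i * (\<Sum>j<n. A $$ (i, j) * q j))"
    by (simp add: sum_distrib_left mult_ac)
  finally have "(\<Sum>i<n. q i * (Re z * p i - Im z * q i)) = (\<Sum>i<n. p i * (Re z * q i + Im z * p i))"
    by (simp add: p q)
  then have "(\<Sum>i<n. p i * (Re z * q i + Im z * p i) - q i * (Re z * p i - Im z * q i)) = 0"
    by (simp add: sum_subtractf)
  then have "Im z * (\<Sum>i<n. (p i)\<^sup>2 + (q i)\<^sup>2) = 0"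
    by (simp add: sum_distrib_left power2_eq_square algebra_simps)
  moreover obtain i where i: "i < n" "w $ i \<noteq> 0"
    using w(1,2) by (metis carrier_vecD eq_vecI index_zero_vec)
  then have "(p i)\<^sup>2 + (q i)\<^sup>2 > 0"
    by (auto simp: p_def q_def complex_eq_iff sum_power2_gt_zero_iff)
  then have "(\<Sum>i<n. (p i)\<^sup>2 + (q i)\<^sup>2) > 0"
    using i(1) by (intro sum_pos2[of _ i]) auto
  ultimately have Im: "Im z = 0" by simp
  \<comment> \<open>With \<open>Im z = 0\<close>, the real and imaginary parts of \<open>w\<close>
    both satisfy the real eigenvalue equation, and one of them is nonzero at
    \<open>i\<close>.\<close>
  have ev: "eigenvalue A (Re z)" if x: "\<And>i. i < n \<Longrightarrow> (\<Sum>j<n. A $$ (i, j) * x j) = Re z * x i"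
    and "x i \<noteq> 0" for x
  proof -
    have "A *\<^sub>v vec n x = Re z \<cdot>\<^sub>v vec n x"
      using A x by (intro eq_vecI) (auto simp: scalar_prod_def lessThan_atLeast0)
    moreover have "vec n x \<noteq> 0\<^sub>v n"
      using i(1) that(2) by (metis index_vec index_zero_vec(1))
    ultimately show ?thesis
      using A unfolding eigenvalue_def eigenvector_def by (intro exI[of _ "vec n x"]) auto
  qed
  show ?thesis
  proof (cases "p i = 0")
    case True
    then have "q i \<noteq> 0" using i(2) by (auto simp: p_def q_def complex_eq_iff)
    then show ?thesis using ev[of q] q Im by auto
  qed (use ev[of p] p Im in auto)
qed

lemma gram_matrix_lessThan:
  fixes G :: "nat pair_pre_digraph"
  assumes "pverts G = {..<n}"
  shows "gram_matrix G f = mat n n (\<lambda>(i, j). f i \<bullet> f j)"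
proof -
  have "sorted_list_of_set (pverts G) = [0..<n]"
    unfolding assms lessThan_atLeast0 by (rule sorted_list_of_set_range)
  then show ?thesis by (auto simp: gram_matrix_def Let_def)
qed

lemma coord_inner_vec:
  assumes "f v \<in> carrier_vec d"
  shows "coord_inner d (\<lambda>v i. f v $ i) u v = f u \<bullet> f v"
  using assms by (simp add: coord_inner_def scalar_prod_def lessThan_atLeast0)

lemma orthonormal_rep_coord_rep:
  assumes "orthonormal_rep G d f"
  shows "coord_rep d (parcs G) (pverts G) (\<lambda>v i. f v $ i)"
  using assms unfolding orthonormal_rep_def coord_rep_def by (simp add: coord_inner_vec)

text \<open>Rayleigh quotient: the Bessel inequality is tested on an eigenvector.\<close>

lemma gram_eigenvalue_le:
  fixes G :: "nat pair_pre_digraph"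
  assumes G: "pverts G = {..<n}" and f: "orthonormal_rep G d f"
    and L: "bessel_bound d (\<lambda>v i. f v $ i) {..<n} L"
    and k: "eigenvalue (gram_matrix G f) k"
  shows "k \<le> L"
proof -
  obtain w where w: "w \<in> carrier_vec n" "w \<noteq> 0\<^sub>v n" "gram_matrix G f *\<^sub>v w = k \<cdot>\<^sub>v w"
    using k by (auto simp: eigenvalue_def eigenvector_def gram_matrix_lessThan[OF G])
  have fd: "f v \<in> carrier_vec d" if "v < n" for v
    using f G that by (simp add: orthonormal_rep_def)
  have eq: "(\<Sum>j<n. (f i \<bullet> f j) * w $ j) = k * w $ i" if "i < n" for i
  proof -
    have "(gram_matrix G f *\<^sub>v w) $ i = (\<Sum>j<n. (f i \<bullet> f j) * w $ j)"
      using w(1) that by (simp add: gram_matrix_lessThan[OF G] scalar_prod_def lessThan_atLeast0)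
    then show ?thesis using w that by simp
  qed
  have "k * (\<Sum>i<n. (w $ i)\<^sup>2) = (\<Sum>i<n. w $ i * (k * w $ i))"
    by (simp add: sum_distrib_left power2_eq_square mult_ac)
  also have "\<dots> = (\<Sum>i<n. w $ i * (\<Sum>j<n. (f i \<bullet> f j) * w $ j))"
    by (simp add: eq)
  also have "\<dots> = (\<Sum>i<n. \<Sum>j<n. w $ i * w $ j * coord_inner d (\<lambda>v i. f v $ i) i j)"
    using fd by (simp add: coord_inner_vec sum_distrib_left mult_ac)
  also have "\<dots> = (\<Sum>i<d. (\<Sum>v<n. w $ v * f v $ i)\<^sup>2)"
    by (rule sum_squares_expand[symmetric])
  also have "\<dots> \<le> L * (\<Sum>i<n. (w $ i)\<^sup>2)"
    using L by (rule bessel_boundD)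
  finally have "k * (\<Sum>i<n. (w $ i)\<^sup>2) \<le> L * (\<Sum>i<n. (w $ i)\<^sup>2)" .
  moreover obtain i where "i < n" "w $ i \<noteq> 0"
    using w(1,2) by (metis carrier_vecD eq_vecI index_zero_vec)
  then have "(\<Sum>i<n. (w $ i)\<^sup>2) > 0"
    by (intro sum_pos2[of _ i]) auto
  ultimately show ?thesis by simp
qed

text \<open>Bounding \<open>Sup\<close> and \<open>Max\<close> from above calls for nonempty sets:
  some representation must exist, and every Gram matrix must have a real eigenvalue.\<close>

lemma lovasz_theta_compl_le:
  fixes G :: "nat pair_pre_digraph"
  assumes G: "pverts G = {..<n}" and n: "n \<ge> 1"
    and L: "\<And>d f. orthonormal_rep G d f \<Longrightarrow> bessel_bound d (\<lambda>v i. f v $ i) {..<n} L"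
  shows "lovasz_theta_compl G \<le> L"
  unfolding lovasz_theta_compl_def
proof (rule cSup_least)
  \<comment> \<open>The standard basis represents every graph on \<open>{..<n}\<close>.\<close>
  have "orthonormal_rep G n (unit_vec n)"
    unfolding orthonormal_rep_def G by auto
  then show "{Max (spectrum (gram_matrix G f)) | d f. orthonormal_rep G d f} \<noteq> {}" by blast
next
  fix x assume "x \<in> {Max (spectrum (gram_matrix G f)) | d f. orthonormal_rep G d f}"
  then obtain d f where x: "x = Max (spectrum (gram_matrix G f))" and f: "orthonormal_rep G d f"
    by blast
  have M: "gram_matrix G f \<in> carrier_mat n n"
    by (simp add: gram_matrix_lessThan[OF G])
  have fd: "f v \<in> carrier_vec d" if "v < n" for v
    using f G that by (simp add: orthonormal_rep_def)
  have "\<exists>k. eigenvalue (gram_matrix G f) k"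
  proof (rule symmetric_real_eigenvalue_exists[OF M])
    fix i j assume "i < n" "j < n"
    then show "gram_matrix G f $$ (i, j) = gram_matrix G f $$ (j, i)"
      using comm_scalar_prod[OF fd fd] by (simp add: gram_matrix_lessThan[OF G])
  qed (use n in simp)
  then have "spectrum (gram_matrix G f) \<noteq> {}" by (auto simp: spectrum_def)
  moreover have "finite (spectrum (gram_matrix G f))"
    using card_finite_spectrum[OF M] by blast
  ultimately show "x \<le> L"
    using gram_eigenvalue_le[OF G f L[OF f]] by (auto simp: x spectrum_def)
qed

section \<open>Forbidden subgraphs as bicliques\<close>

text \<open>Enumerations of \<open>T\<close> and \<open>S\<close> glue to an injection of the
  vertices of the complete bipartite graph, whose image is a forbidden subgraph.\<close>

lemma graph_free_complete_bipartite_biclique_free: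
  assumes G: "pair_graph G" and free: "graph_free (complete_bipartite t s) G"
  shows "biclique_free (parcs G) t s (pverts G)"
  unfolding biclique_free_def
proof
  interpret G: pair_graph G by fact
  assume "\<exists>T S. T \<subseteq> pverts G \<and> S \<subseteq> pverts G \<and> card T = t \<and> card S = s \<and> T \<times> S \<subseteq> parcs G"
  then obtain T S where TS: "T \<subseteq> pverts G" "S \<subseteq> pverts G" "card T = t" "card S = s"
    "T \<times> S \<subseteq> parcs G" by blast
  have fin: "finite T" "finite S" using TS(1,2) G.pair_finite_verts by (auto intro: finite_subset)
  have disj: "T \<inter> S = {}" using TS(5) G.no_loops' by blast
  \<comment> \<open>An edge is a pair of opposite arcs, so the reversed arcs must be present
    too.\<close>
  have ST: "S \<times> T \<subseteq> parcs G"
    using TS(5) G.arcs_symmetric by blast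
  obtain g where g: "bij_betw g {..<t} T"
    using fin(1) TS(3) by (metis bij_betw_iff_card card_lessThan finite_lessThan)
  obtain h where h: "bij_betw h {t..<t + s} S"
    using fin(2) TS(4) by (metis bij_betw_iff_card card_atLeastLessThan diff_add_inverse finite_atLeastLessThan)
  define \<phi> where "\<phi> = (\<lambda>i. if i < t then g i else h i)"
  have \<phi>T: "bij_betw \<phi> {..<t} T"
    using g by (rule bij_betw_cong[THEN iffD1, rotated]) (simp add: \<phi>_def)
  have \<phi>S: "bij_betw \<phi> {t..<t + s} S"
    using h by (rule bij_betw_cong[THEN iffD1, rotated]) (simp add: \<phi>_def)
  let ?H = "with_proj (complete_bipartite t s)"
  have vH: "verts ?H = {..<t} \<union> {t..<t + s}"
    by (auto simp: complete_bipartite_def)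
  have aH: "arcs ?H = {..<t} \<times> {t..<t + s} \<union> {t..<t + s} \<times> {..<t}"
    by (simp add: complete_bipartite_def)
  have inj: "inj_on \<phi> (verts ?H)"
    unfolding vH using bij_betw_combine[OF \<phi>T \<phi>S disj] by (rule bij_betw_imp_inj_on)
  \<comment> \<open>The isomorphism also moves arcs; image arcs are again pairs, with tail
    \<open>fst\<close> and head \<open>snd\<close>.\<close>
  define hom where "hom = \<lparr>iso_verts = \<phi>, iso_arcs = map_prod \<phi> \<phi>, iso_head = snd, iso_tail = fst\<rparr>"
  have wfH: "wf_digraph ?H"
    by unfold_locales (auto simp: complete_bipartite_def)
  have "inj_on (map_prod \<phi> \<phi>) (arcs ?H)"
    using map_prod_inj_on[OF inj inj] by (rule inj_on_subset) (unfold vH aH, blast)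
  with inj wfH have iso: "pre_digraph.digraph_isomorphism ?H hom"
    unfolding pre_digraph.digraph_isomorphism_def by (simp add: hom_def)
  have aF: "arcs (app_iso hom ?H) \<subseteq> parcs G"
  proof -
    have "arcs (app_iso hom ?H) \<subseteq> T \<times> S \<union> S \<times> T"
      using bij_betw_imp_surj_on[OF \<phi>T] bij_betw_imp_surj_on[OF \<phi>S]
      unfolding arcs_app_iso aH by (auto simp: hom_def)
    then show ?thesis using TS(5) ST by blast
  qed
  have vF: "verts (app_iso hom ?H) \<subseteq> pverts G"
    using bij_betw_imp_surj_on[OF \<phi>T] bij_betw_imp_surj_on[OF \<phi>S] TS(1,2)
    unfolding verts_app_iso vH by (auto simp: hom_def)
  have "subgraph (app_iso hom ?H) (with_proj G)"
    unfolding subgraph_def compatible_def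
    using vF aF wf_digraph.wf_digraphI_app_iso[OF wfH iso] G.wf_digraph
    by (simp add: hom_def)
  moreover have "digraph_iso ?H (app_iso hom ?H)"
    unfolding digraph_iso_def using iso by blast
  ultimately show False using free unfolding graph_free_def by blast
qed

text \<open>This supplies a member of the family over which \<open>max_theta_free\<close> takes its
  maximum.\<close>

lemma graph_free_arcless:
  assumes "t \<ge> 1" "s \<ge> 1" "parcs G = {}"
  shows "graph_free (complete_bipartite t s) G"
proof -
  have "(0, t) \<in> parcs (complete_bipartite t s)"
    using assms by (simp add: complete_bipartite_def)
  then show ?thesis
    using assms(3) by (auto simp: graph_free_def subgraph_def digraph_iso_def)
qed

theorem theorem1p7:
  fixes s t :: nat
  assumes "t \<ge> 2" and "s \<ge> t"
  shows "\<exists>c :: real. \<forall>n :: nat. n \<ge> 1 \<longrightarrow>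
    max_theta_free n (complete_bipartite t s)
      \<le> c * real n powr (1 - 2 / real t + 1 / (real t * 2 ^ (t - 1)))"
proof -
  obtain c where c: "\<And>d (a :: nat \<Rightarrow> nat \<Rightarrow> real) E V. finite V \<Longrightarrow> irrefl E \<Longrightarrow> sym E \<Longrightarrow>
      biclique_free E t s V \<Longrightarrow> coord_rep d E V a \<Longrightarrow>
      bessel_bound d a V (c * real (card V) powr theta_exponent t)"
    using bessel_bound_biclique_free[of t s] assms by (metis le_trans one_le_numeral)
  show ?thesis
    unfolding theta_exponent_def[symmetric]
  proof (intro exI allI impI)
    fix n :: nat assume n: "n \<ge> 1"
    let ?\<G> = "{G :: nat pair_pre_digraph.
      pair_graph G \<and> pverts G = {..<n} \<and> graph_free (complete_bipartite t s) G}"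
    have img: "{lovasz_theta_compl G | G :: nat pair_pre_digraph. pair_graph G \<and> pverts G = {..<n} \<and>
        graph_free (complete_bipartite t s) G} = lovasz_theta_compl ` ?\<G>"
      by blast
    \<comment> \<open>A graph on \<open>{..<n}\<close> is determined by its arc set, so the family
      is finite, as \<open>Max\<close> requires.\<close>
    have "?\<G> \<subseteq> (\<lambda>A. \<lparr>pverts = {..<n}, parcs = A\<rparr>) ` Pow ({..<n} \<times> {..<n})"
    proof
      fix G assume "G \<in> ?\<G>"
      then interpret G: pair_graph G by simp
      have "parcs G \<in> Pow ({..<n} \<times> {..<n})"
        using \<open>G \<in> ?\<G>\<close> G.in_arcsD1 G.in_arcsD2 by auto
      moreover have "G = \<lparr>pverts = {..<n}, parcs = parcs G\<rparr>"
        using \<open>G \<in> ?\<G>\<close> by simp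
      ultimately show "G \<in> (\<lambda>A. \<lparr>pverts = {..<n}, parcs = A\<rparr>) ` Pow ({..<n} \<times> {..<n})"
        by blast
    qed
    then have "finite ?\<G>" by (rule finite_subset) simp
    moreover have "\<lparr>pverts = {..<n}, parcs = {}\<rparr> \<in> ?\<G>"
    proof -
      have "pair_graph \<lparr>pverts = {..<n}, parcs = {}\<rparr>"
        by unfold_locales (auto simp: symmetric_conv)
      then show ?thesis using assms by (simp add: graph_free_arcless)
    qed
    moreover have "lovasz_theta_compl G \<le> c * real n powr theta_exponent t" if "G \<in> ?\<G>" for G
    proof (rule lovasz_theta_compl_le)
      from that interpret G: pair_graph G by simp
      show V: "pverts G = {..<n}" using that by simp
      fix d f assume f: "orthonormal_rep G d f"
      have "irrefl (parcs G)" using G.no_loops' by (auto simp: irrefl_def)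
      moreover have "sym (parcs G)" using G.arcs_symmetric by (auto simp: sym_def)
      moreover have "biclique_free (parcs G) t s {..<n}"
        using graph_free_complete_bipartite_biclique_free[of G t s] that by simp
      moreover have "coord_rep d (parcs G) {..<n} (\<lambda>v i. f v $ i)"
        using orthonormal_rep_coord_rep[OF f] V by simp
      ultimately show "bessel_bound d (\<lambda>v i. f v $ i) {..<n} (c * real n powr theta_exponent t)"
        using c[of "{..<n}"] by simp
    qed (rule n)
    ultimately show "max_theta_free n (complete_bipartite t s) \<le> c * real n powr theta_exponent t"
      unfolding max_theta_free_def img by (intro Max.boundedI) blast+
  qed
qed

end
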